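(* Let $(\alpha_n)_{n\ge 1}$ be a sequence of positive and pairwise distinct real numbers with $\lim_{n\to\infty}\alpha_n=0$ and $\sum_{n\ge 1}\alpha_n=\infty$. Let $f$ be a probability density on $[0,1]$ (with respect to Lebesgue measure) whose entropy $S(f)=-\int_0^1 f(y)\ln f(y)\,dy$ is finite, and put $\mu(\alpha_i)=\int_0^1 y^{\alpha_i}f(y)\,dy$ for $i\ge 1$. For each $K\ge 1$ let $f_K$ be the maximum entropy solution of the truncated fractional moment problem with data $\mu(\alpha_1),\dots,\mu(\alpha_K)$. Then: 1. $S(f_K)$ decreases to $S(f)$ as $K\to\infty$. 2. $\|f_K-f\|\to 0$ as $K\to\infty$, where $\|\cdot\|$ is the norm of $L_1([0,1],dy)$.
   Context: For a probability density $g$ on $[0,1]$, the entropy is $S(g)=-\int_0^1 g(y)\ln g(y)\,dy\in[-\infty,+\infty)$ (with $0\ln 0=0$), set to $-\infty$ when the integral fails to converge. The truncated fractional moment problem with data $\mu(\alpha_1),\dots,\mu(\alpha_K)$ is: find a probability density $g$ on $[0,1]$ with $\int_0^1 y^{\alpha_i}g(y)\,dy=\mu(\alpha_i)$ for $i=1,\dots,K$. Its maximum entropy (maxentropic) solution $f_K$ is the density that maximizes $S(g)$ among all probability densities $g$ satisfying these $K$ constraints; it is of the form $$f_K(y)=\frac{\exp\left(-\sum_{i=1}^K\lambda_i^* y^{\alpha_i}\right)}{Z(\lambda^* )},\qquad Z(\lambda)=\int_0^1 \exp\left(-\sum_{i=1}^K\lambda_i y^{\alpha_i}\right)dy,$$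 where $\lambda^*\in\mathbb{R}^K$ minimizes the strictly convex function $\lambda\mapsto \ln Z(\lambda)+\sum_{i=1}^K\lambda_i\mu(\alpha_i)$ over $\mathbb{R}^K$. "Decreases to" means that the sequence is nonincreasing in $K$ and converges to the indicated limit. *)

theory Defs
  imports "HOL-Analysis.Analysis"
begin

abbreviation leb01 :: "real measure" where
  "leb01 \<equiv> lebesgue_on {0..1}"

definition prob_density01 :: "(real \<Rightarrow> real) \<Rightarrow> bool" where
  "prob_density01 g \<longleftrightarrow> (\<forall>y\<in>{0..1}. 0 \<le> g y) \<and> has_bochner_integral leb01 g 1"

(* The entropy of information_space in HOL-Probability is real-valued and becomes 0 instead of
   -\<infinity> when g ln g is not integrable, so it is not used here. For a probability density g,
   g ln g \<ge> - 1/e, so integrability fails only if the integral of g ln g is +\<infinity>.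
   The convention 0 ln 0 = 0 holds in HOL. *)
definition entropy01 :: "(real \<Rightarrow> real) \<Rightarrow> ereal" where
  "entropy01 g =
     (if integrable leb01 (\<lambda>y. g y * ln (g y))
      then ereal (- (\<integral>y. g y * ln (g y) \<partial>leb01))
      else -\<infinity>)"

(* For a > 0, the value 0 powr a = 0 is the usual one. *)
definition frac_moment :: "real \<Rightarrow> (real \<Rightarrow> real) \<Rightarrow> real" where
  "frac_moment a g = (\<integral>y. y powr a * g y \<partial>leb01)"

definition solves_moment_problem ::
    "(nat \<Rightarrow> real) \<Rightarrow> (nat \<Rightarrow> real) \<Rightarrow> nat \<Rightarrow> (real \<Rightarrow> real) \<Rightarrow> bool" where
  "solves_moment_problem \<alpha> \<mu> K g \<longleftrightarrow>
     prob_density01 g \<and> (\<forall>i\<in>{1..K}. frac_moment (\<alpha> i) g = \<mu> i)"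

(* Densities are functions, so a maximum entropy solution is determined only up to
   equality almost everywhere; this is therefore a predicate. *)
definition maxent_solution ::
    "(nat \<Rightarrow> real) \<Rightarrow> (nat \<Rightarrow> real) \<Rightarrow> nat \<Rightarrow> (real \<Rightarrow> real) \<Rightarrow> bool" where
  "maxent_solution \<alpha> \<mu> K g \<longleftrightarrow>
     solves_moment_problem \<alpha> \<mu> K g \<and>
     (\<forall>h. solves_moment_problem \<alpha> \<mu> K h \<longrightarrow> entropy01 h \<le> entropy01 g)"

end

theory Submission
  imports Defs "HOL-Complex_Analysis.Conformal_Mappings"
begin

text \<open>The midpoint of two densities that satisfy the first K constraints satisfies them as well, so
  quantitative midpoint convexity of x ln x bounds the L1 distance of maximum entropy solutions by
  the drop of their entropies. The entropies are nonincreasing in K and bounded below by the entropy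
  of f, hence the solutions form a Cauchy sequence in L1, and the limit g has the same fractional
  moments as f.

  To see that g = f, put h = g - f. The function F(z) = \<open>\<integral>\<close> y^z h(y) dy is bounded and holomorphic on the
  right half-plane and vanishes at all \<open>\<alpha>\<close>(n). As the \<open>\<alpha>\<close>(n) tend to 0 and have infinite sum,
  they violate the Blaschke condition, so F = 0. In particular all integer moments of h vanish, so h = 0
  almost everywhere.

  Fatou's lemma, applied to x ln x + 1 along an almost everywhere convergent subsequence, shows that
  the limit of the entropies does not exceed the entropy of f.\<close>

section \<open>Bounded holomorphic functions on the right half-plane\<close>

text \<open>Schwarz's lemma on the unit disc, transported by the Moebius map that sends 0 to a.\<close>

lemma right_half_plane_divide_zero:
  fixes F :: "complex \<Rightarrow> complex" and a :: real
  assumes hol: "F holomorphic_on {z. Re z > 0}"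
    and bound: "\<And>z. Re z > 0 \<Longrightarrow> norm (F z) \<le> M"
    and a: "a > 0" and zero: "F (of_real a) = 0"
  obtains G where "G holomorphic_on {z. Re z > 0}"
    and "\<And>z. Re z > 0 \<Longrightarrow> norm (G z) \<le> M"
    and "\<And>z. Re z > 0 \<Longrightarrow> F z = (z - of_real a) / (z + of_real a) * G z"
proof -
  define \<phi> where "\<phi> w = of_real a * (1 + w) / (1 - w)" for w :: complex
  define \<psi> where "\<psi> z = (z - of_real a) / (z + of_real a)" for z :: complex
  have \<phi>_Re: "Re (\<phi> w) > 0" if "norm w < 1" for w
  proof -
    have w1: "w \<noteq> 1" using that by auto
    have "(Re w)\<^sup>2 + (Im w)\<^sup>2 < 1"
      using that by (metis cmod_power2 norm_ge_zero one_power2 power_strict_mono zero_less_numeral)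
    \<comment> \<open>Multiplying numerator and denominator of (1 + w) / (1 - w) by the conjugate of
      1 - w leaves the real part 1 - |w|^2 in the numerator.\<close>
    moreover have "Re (\<phi> w) = a * (1 - ((Re w)\<^sup>2 + (Im w)\<^sup>2)) / (cmod (1 - w))\<^sup>2"
      unfolding \<phi>_def Re_divide'
      by (simp add: algebra_simps power2_eq_square)
    ultimately show ?thesis using a w1 by simp
  qed
  have \<psi>_norm: "norm (\<psi> z) < 1" and \<phi>\<psi>: "\<phi> (\<psi> z) = z" if "Re z > 0" for z
  proof -
    have nz: "z + of_real a \<noteq> 0"
      using that a by (metis Re_complex_of_real add_pos_pos less_irrefl plus_complex.simps(1) zero_complex.simps(1))
    \<comment> \<open>A point of the right half-plane is closer to \<open>a\<close> than to the
      mirror image -a.\<close>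
    have "norm (z - of_real a) < norm (z + of_real a)"
      using that a unfolding cmod_def
      by (intro real_sqrt_less_mono) (simp add: power2_eq_square algebra_simps)
    then show "norm (\<psi> z) < 1" using nz by (simp add: \<psi>_def norm_divide)
    have "1 + \<psi> z = 2 * z / (z + of_real a)" "1 - \<psi> z = 2 * of_real a / (z + of_real a)"
      using nz by (simp_all add: \<psi>_def field_simps)
    then show "\<phi> (\<psi> z) = z" using nz a by (simp add: \<phi>_def)
  qed
  have hol\<phi>: "\<phi> holomorphic_on ball 0 1"
    unfolding \<phi>_def by (intro holomorphic_intros) auto
  have hol\<psi>: "\<psi> holomorphic_on {z. Re z > 0}"
    unfolding \<psi>_def using a by (intro holomorphic_intros) (auto simp: complex_eq_iff)
  have holH: "(\<lambda>w. F (\<phi> w)) holomorphic_on ball 0 1"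
    using holomorphic_on_compose_gen[OF hol\<phi> hol] \<phi>_Re by (auto simp: o_def image_subset_iff)
  have H0: "F (\<phi> 0) = 0" using zero by (simp add: \<phi>_def)
  obtain q where holq: "q holomorphic_on ball 0 1"
    and q: "\<And>w. norm w < 1 \<Longrightarrow> F (\<phi> w) = w * q w"
    and q0: "deriv (\<lambda>w. F (\<phi> w)) 0 = q 0"
    using Schwarz3[OF holH H0] by blast
  \<comment> \<open>The Schwarz lemma is stated for functions of modulus strictly below 1, so F o
    \<open>\<phi>\<close> is divided by some \<open>M' > M\<close>. Away from 0 it bounds |w q(w)|
    by \<open>M'\<close> |w|; at 0 it bounds the derivative, which is \<open>q 0\<close>. Letting
    \<open>M'\<close> decrease to \<open>M\<close> gives \<open>qM\<close>.\<close>
  have qM': "norm (q w) \<le> M'" if M': "M' > M" and w: "norm w < 1" for M' w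
  proof -
    have "M \<ge> 0" using bound[of 1] order_trans[OF norm_ge_zero] by force
    then have pos: "M' > 0" using M' by simp
    let ?h = "\<lambda>w. F (\<phi> w) / of_real M'"
    have holh: "?h holomorphic_on ball 0 1"
      using holH pos by (intro holomorphic_intros) auto
    have h1: "norm (?h z) < 1" if "norm z < 1" for z
      using bound[OF \<phi>_Re[OF that]] M' pos by (simp add: norm_divide)
    have h0: "?h 0 = 0" using H0 by simp
    note SL = Schwarz_Lemma(1,2)[OF holh h0 h1 w]
    show ?thesis
    proof (cases "w = 0")
      case True
      have "(\<lambda>w. F (\<phi> w)) field_differentiable at 0"
        using holH by (auto intro: holomorphic_on_imp_differentiable_at)
      then have "deriv ?h 0 = q 0 / of_real M'"
        using q0 by (simp add: deriv_cdivide_right)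
      then show ?thesis using SL(2) True pos by (simp add: norm_divide)
    next
      case False
      then show ?thesis using SL(1) q[OF w] pos by (simp add: norm_divide norm_mult field_simps)
    qed
  qed
  have qM: "norm (q w) \<le> M" if "norm w < 1" for w
    using qM'[OF _ that] by (meson dense_ge)
  show ?thesis
  proof
    show "(\<lambda>z. q (\<psi> z)) holomorphic_on {z. Re z > 0}"
      using holomorphic_on_compose_gen[OF hol\<psi> holq] \<psi>_norm by (auto simp: o_def image_subset_iff)
    show "norm (q (\<psi> z)) \<le> M" if "Re z > 0" for z
      using qM \<psi>_norm[OF that] by blast
    show "F z = (z - of_real a) / (z + of_real a) * q (\<psi> z)" if "Re z > 0" for z
      using q[OF \<psi>_norm[OF that]] \<phi>\<psi>[OF that] by (simp add: \<psi>_def)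
  qed
qed

text \<open>The zeros are divided out one at a time. Each quotient keeps the same bound
  \<open>M\<close>, so the induction collects one Blaschke factor per zero.\<close>

lemma norm_le_Blaschke_product:
  fixes F :: "complex \<Rightarrow> complex" and A :: "real set"
  assumes "finite A" "\<And>a. a \<in> A \<Longrightarrow> a > 0"
    and "F holomorphic_on {z. Re z > 0}"
    and "\<And>z. Re z > 0 \<Longrightarrow> norm (F z) \<le> M"
    and "\<And>a. a \<in> A \<Longrightarrow> F (of_real a) = 0"
    and "Re z > 0"
  shows "norm (F z) \<le> M * (\<Prod>a\<in>A. norm ((z - of_real a) / (z + of_real a)))"
  using assms
proof (induction A arbitrary: F rule: finite_induct)
  case empty
  then show ?case by simp
next
  case (insert a A)
  obtain G where G: "G holomorphic_on {z. Re z > 0}" "\<And>z. Re z > 0 \<Longrightarrow> norm (G z) \<le> M"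
    and FG: "\<And>z. Re z > 0 \<Longrightarrow> F z = (z - of_real a) / (z + of_real a) * G z"
    using right_half_plane_divide_zero[of F M a] insert.prems by blast
  \<comment> \<open>A remaining zero \<open>b\<close> passes to the quotient, since
    \<open>b \<noteq> a\<close> makes the removed factor nonzero there.\<close>
  have "G (of_real b) = 0" if b: "b \<in> A" for b
  proof -
    have "b > 0" "a > 0" "b \<noteq> a" using insert b by auto
    then have "(of_real b - of_real a) / (of_real b + of_real a) \<noteq> (0::complex)"
      by (metis add_pos_pos divide_eq_0_iff of_real_add of_real_eq_0_iff of_real_eq_iff
          order_less_irrefl right_minus_eq)
    then show ?thesis using FG[of "of_real b"] insert.prems(4)[of b] b \<open>b > 0\<close>
      by (metis Re_complex_of_real insertCI mult_eq_0_iff)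
  qed
  then have "norm (G z) \<le> M * (\<Prod>a\<in>A. norm ((z - of_real a) / (z + of_real a)))"
    using insert.IH[of G] insert.prems G by blast
  then have "norm ((z - of_real a) / (z + of_real a)) * norm (G z) \<le>
    norm ((z - of_real a) / (z + of_real a)) * (M * (\<Prod>a\<in>A. norm ((z - of_real a) / (z + of_real a))))"
    by (rule mult_left_mono) simp
  also have "\<dots> = M * (\<Prod>a\<in>insert a A. norm ((z - of_real a) / (z + of_real a)))"
    using insert.hyps by (simp add: mult_ac)
  finally show ?case
    by (simp only: FG[OF insert.prems(5)] norm_mult)
qed

text \<open>At \<open>x\<close> the Blaschke factor of a zero a < x is at most exp(-a/x). The
  product over many zeros is then bounded by the exponential of a multiple of a partial sum that
  tends to minus infinity.\<close>

lemma bounded_right_half_plane_eq_0: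
  fixes F :: "complex \<Rightarrow> complex" and \<alpha> :: "nat \<Rightarrow> real"
  assumes hol: "F holomorphic_on {z. Re z > 0}"
    and bound: "\<And>z. Re z > 0 \<Longrightarrow> norm (F z) \<le> M"
    and pos: "\<And>n. n \<ge> 1 \<Longrightarrow> \<alpha> n > 0"
    and inj: "inj_on \<alpha> {1..}"
    and lim0: "\<alpha> \<longlonglongrightarrow> 0"
    and diverges: "filterlim (\<lambda>N. \<Sum>n=1..N. \<alpha> n) at_top sequentially"
    and zeros: "\<And>n. n \<ge> 1 \<Longrightarrow> F (of_real (\<alpha> n)) = 0"
    and x: "x > 0"
  shows "F (of_real x) = 0"
proof -
  obtain N0 where N0: "\<And>n. n \<ge> N0 \<Longrightarrow> \<alpha> n < x"
    using order_tendstoD(2)[OF lim0 x] by (auto simp: eventually_sequentially)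
  \<comment> \<open>From \<open>m\<close> on, every index is at least 1, where positivity,
    injectivity and the zeros are given, and \<open>\<alpha> n < x\<close>.\<close>
  define m where "m = Suc N0"
  have M0: "M \<ge> 0" using bound[of 1] order_trans[OF norm_ge_zero] by force
  have factor: "norm ((of_real x - of_real a) / (of_real x + of_real a) :: complex) \<le> exp (- a / x)"
    if "0 < a" "a < x" for a
  proof -
    have "norm ((of_real x - of_real a) / (of_real x + of_real a) :: complex) = (x - a) / (x + a)"
      using that x by (simp add: norm_divide flip: of_real_diff of_real_add)
    \<comment> \<open>Shrinking the denominator from x + a to x enlarges the quotient, as the
      numerator is positive.\<close>
    also have "\<dots> \<le> 1 + - a / x"
      using that x by (simp add: field_simps)
    also have "\<dots> \<le> exp (- a / x)" by (rule exp_ge_add_one_self)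
    finally show ?thesis .
  qed
  have le: "norm (F (of_real x)) \<le> M * exp (- (\<Sum>n=m..N. \<alpha> n) / x)" for N
  proof -
    have sub: "{m..N} \<subseteq> {1..}" by (auto simp: m_def)
    have "norm (F (of_real x)) \<le>
        M * (\<Prod>a\<in>\<alpha> ` {m..N}. norm ((of_real x - of_real a) / (of_real x + of_real a) :: complex))"
      using pos zeros sub x by (intro norm_le_Blaschke_product hol bound) force+
    also have "\<dots> = M * (\<Prod>n=m..N. norm ((of_real x - of_real (\<alpha> n)) / (of_real x + of_real (\<alpha> n)) :: complex))"
      by (subst prod.reindex[OF inj_on_subset[OF inj sub]]) simp
    also have "\<dots> \<le> M * (\<Prod>n=m..N. exp (- \<alpha> n / x))"
      using pos N0 M0 by (intro mult_left_mono prod_mono conjI factor) (auto simp: m_def)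
    also have "(\<Prod>n=m..N. exp (- \<alpha> n / x)) = exp (- (\<Sum>n=m..N. \<alpha> n) / x)"
      by (simp add: exp_sum[symmetric] sum_negf sum_divide_distrib)
    finally show ?thesis .
  qed
  \<comment> \<open>Dropping finitely many terms does not affect divergence.\<close>
  have split: "(\<Sum>n=m..N. \<alpha> n) = (\<Sum>n=1..N. \<alpha> n) - (\<Sum>n=1..N0. \<alpha> n)" if "N \<ge> N0" for N
  proof -
    have "{1..N} = {1..N0} \<union> {m..N}" "{1..N0} \<inter> {m..N} = {}" using that by (auto simp: m_def)
    then show ?thesis by (simp add: sum.union_disjoint)
  qed
  have "filterlim (\<lambda>N. - (\<Sum>n=1..N0. \<alpha> n) + (\<Sum>n=1..N. \<alpha> n)) at_top sequentially"
    by (rule filterlim_tendsto_add_at_top[OF tendsto_const diverges])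
  then have "filterlim (\<lambda>N. (\<Sum>n=m..N. \<alpha> n)) at_top sequentially"
    by (rule filterlim_cong[OF refl refl, THEN iffD1, rotated])
       (auto simp: split intro!: eventually_sequentiallyI[of N0])
  then have "filterlim (\<lambda>N. - (\<Sum>n=m..N. \<alpha> n) / x) at_bot sequentially"
    using x filterlim_tendsto_pos_mult_at_top[OF tendsto_const, of "1 / x" "\<lambda>N. \<Sum>n=m..N. \<alpha> n"]
    by (simp add: filterlim_uminus_at_bot)
  then have "(\<lambda>N. M * exp (- (\<Sum>n=m..N. \<alpha> n) / x)) \<longlonglongrightarrow> M * 0"
    by (intro tendsto_mult_left filterlim_compose[OF exp_at_bot])
  then have "norm (F (of_real x)) \<le> M * 0"
    by (rule LIMSEQ_le_const) (use le in auto)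
  then show ?thesis by simp
qed

section \<open>Integration\<close>

text \<open>Fatou's lemma for real integrals: nonnegativity and a uniform bound on the integrals
  replace a dominating function and yield integrability of the limit as well.\<close>

lemma Fatou_integral_le:
  fixes u :: "nat \<Rightarrow> 'a \<Rightarrow> real"
  assumes u: "\<And>n. integrable M (u n)" "\<And>n. AE x in M. 0 \<le> u n x"
    and le: "\<And>n. (\<integral>x. u n x \<partial>M) \<le> B"
    and lim: "AE x in M. (\<lambda>n. u n x) \<longlonglongrightarrow> v x"
    and v: "v \<in> borel_measurable M"
  shows "integrable M v" "(\<integral>x. v x \<partial>M) \<le> B"
proof -
  have B0: "B \<ge> 0"
    using le[of 0] integral_nonneg_AE[OF u(2)[of 0]] by linarith
  have u_nonneg: "AE x in M. \<forall>n. 0 \<le> u n x"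
    using u(2) by (simp add: AE_all_countable)
  have v0: "AE x in M. 0 \<le> v x"
    using lim u_nonneg by eventually_elim (auto intro: LIMSEQ_le_const)
  have "(\<integral>\<^sup>+x. ennreal (v x) \<partial>M) = (\<integral>\<^sup>+x. liminf (\<lambda>n. ennreal (u n x)) \<partial>M)"
    using lim by (intro nn_integral_cong_AE, eventually_elim)
      (metis lim_imp_Liminf tendsto_ennrealI trivial_limit_sequentially)
  also have "\<dots> \<le> liminf (\<lambda>n. \<integral>\<^sup>+x. ennreal (u n x) \<partial>M)"
    using u(1) by (intro nn_integral_liminf) auto
  also have "\<dots> = liminf (\<lambda>n. ennreal (\<integral>x. u n x \<partial>M))"
    by (simp add: nn_integral_eq_integral u)
  also have "\<dots> \<le> liminf (\<lambda>n. ennreal B)"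
    by (intro Liminf_mono always_eventually) (simp add: le ennreal_leI)
  finally have nn: "(\<integral>\<^sup>+x. ennreal (v x) \<partial>M) \<le> ennreal B"
    by (simp add: Liminf_const)
  then show int: "integrable M v"
    by (intro integrableI_nonneg v v0) (auto simp: le_less_trans)
  show "(\<integral>x. v x \<partial>M) \<le> B"
    using nn B0 by (simp add: nn_integral_eq_integral int v0)
qed

text \<open>Some subsequence converges almost everywhere, and Fatou's lemma carries the Cauchy
  estimate over to its limit. Both modes of convergence are kept: the one in L1 passes to moments,
  the pointwise one to the entropy.\<close>

lemma L1_complete:
  fixes s :: "nat \<Rightarrow> 'a \<Rightarrow> real"
  assumes s: "\<And>n. integrable M (s n)"
    and cau: "\<And>e. e > 0 \<Longrightarrow> \<exists>N. \<forall>i\<ge>N. \<forall>j\<ge>N. (\<integral>x. \<bar>s i x - s j x\<bar> \<partial>M) < e"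
  obtains g r where "integrable M g" "strict_mono r"
    "AE x in M. (\<lambda>i. s (r i) x) \<longlonglongrightarrow> g x"
    "(\<lambda>n. \<integral>x. \<bar>s n x - g x\<bar> \<partial>M) \<longlonglongrightarrow> 0"
proof -
  obtain r where r: "strict_mono r" and "AE x in M. Cauchy (\<lambda>i. s (r i) x)"
    using cauchy_L1_AE_cauchy_subseq[of M s, OF s, unfolded real_norm_def, OF cau] by blast
  \<comment> \<open>Where the subsequence diverges, \<open>lim\<close> has an unspecified value;
    this happens only on a null set.\<close>
  define g where "g x = lim (\<lambda>i. s (r i) x)" for x
  have lim: "AE x in M. (\<lambda>i. s (r i) x) \<longlonglongrightarrow> g x"
    using \<open>AE x in M. Cauchy _\<close>
    by eventually_elim (simp add: g_def Cauchy_convergent_iff convergent_LIMSEQ_iff)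
  have meas [measurable]: "s n \<in> borel_measurable M" for n using s by auto
  have g [measurable]: "g \<in> borel_measurable M" unfolding g_def by measurable
  have tail: "integrable M (\<lambda>x. \<bar>s n x - g x\<bar>) \<and> (\<integral>x. \<bar>s n x - g x\<bar> \<partial>M) \<le> e"
    if N: "\<forall>i\<ge>N. \<forall>j\<ge>N. (\<integral>x. \<bar>s i x - s j x\<bar> \<partial>M) < e" and n: "n \<ge> N" for n N e
  proof -
    \<comment> \<open>As \<open>r k \<ge> k\<close>, the shift by \<open>N\<close> puts every index
      of the subsequence into the range of the Cauchy estimate.\<close>
    have le: "(\<integral>x. \<bar>s n x - s (r (i + N)) x\<bar> \<partial>M) \<le> e" for i
      using N n seq_suble[OF r, of "i + N"] by (simp add: less_imp_le)
    have conv: "AE x in M. (\<lambda>i. \<bar>s n x - s (r (i + N)) x\<bar>) \<longlonglongrightarrow> \<bar>s n x - g x\<bar>"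
      using lim by eventually_elim (intro tendsto_intros LIMSEQ_ignore_initial_segment)
    show ?thesis
      using Fatou_integral_le[OF _ _ le conv] s by auto
  qed
  obtain N where "\<forall>i\<ge>N. \<forall>j\<ge>N. (\<integral>x. \<bar>s i x - s j x\<bar> \<partial>M) < 1" using cau[of 1] by auto
  then have "integrable M (\<lambda>x. s N x - g x)"
    using tail[of N 1 N] by (auto simp: integrable_abs_iff)
  from Bochner_Integration.integrable_diff[OF s[of N] this] have "integrable M g" by simp
  moreover have "(\<lambda>n. \<integral>x. \<bar>s n x - g x\<bar> \<partial>M) \<longlonglongrightarrow> 0"
  proof (rule LIMSEQ_I)
    fix e :: real assume "e > 0"
    then obtain N where "\<forall>i\<ge>N. \<forall>j\<ge>N. (\<integral>x. \<bar>s i x - s j x\<bar> \<partial>M) < e / 2"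
      using cau[of "e / 2"] by auto
    then have "(\<integral>x. \<bar>s n x - g x\<bar> \<partial>M) \<le> e / 2" if "n \<ge> N" for n using tail that by blast
    then show "\<exists>N. \<forall>n\<ge>N. norm ((\<integral>x. \<bar>s n x - g x\<bar> \<partial>M) - 0) < e"
      using \<open>e > 0\<close> by (intro exI[of _ N]) (force intro: le_less_trans simp: abs_of_nonneg)
  qed
  ultimately show ?thesis using that r lim by blast
qed

section \<open>Integrable functions on the unit interval and their power moments\<close>

lemma AE_leb01_neq_0: "AE y in leb01. y \<noteq> (0::real)"
proof -
  have "{0::real} \<in> null_sets leb01"
    by (simp add: null_sets_restrict_space)
  then show ?thesis by (rule AE_I') auto
qed

lemma integrable_leb01_mult_bounded:
  fixes h c :: "real \<Rightarrow> real"
  assumes h: "integrable leb01 h" and c: "c \<in> borel_measurable leb01"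
    and B: "\<And>y. y \<in> {0..1} \<Longrightarrow> \<bar>c y\<bar> \<le> B"
  shows "integrable leb01 (\<lambda>y. c y * h y)"
proof (rule Bochner_Integration.integrable_bound[of _ "\<lambda>y. B * h y"])
  show "AE y in leb01. norm (c y * h y) \<le> norm (B * h y)"
    using B by (intro AE_I2) (force simp: abs_mult intro!: mult_right_mono)
qed (use h c in auto)

lemma borel_measurable_leb01: "c \<in> borel_measurable borel \<Longrightarrow> c \<in> borel_measurable leb01"
  by (simp add: measurable_restrict_space1 measurable_completion)

text \<open>By Weierstrass approximation \<open>h\<close> is orthogonal to all continuous functions.
  Approximating the sign of \<open>h\<close> by continuous functions then shows that the integral of
  |h| is 0.\<close>

lemma AE_eq_0_if_power_moments_eq_0:
  fixes h :: "real \<Rightarrow> real"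
  assumes h: "integrable leb01 h"
    and mom: "\<And>n::nat. (\<integral>y. y ^ n * h y \<partial>leb01) = 0"
  shows "AE y in leb01. h y = 0"
proof -
  have pw: "integrable leb01 (\<lambda>y. y ^ n * h y)" for n :: nat
    by (rule integrable_leb01_mult_bounded[OF h, where B=1])
       (auto intro!: borel_measurable_leb01 simp: power_le_one)
  have poly: "(\<integral>y. p y * h y \<partial>leb01) = 0" if p: "real_polynomial_function p" for p
  proof -
    obtain a n where "p = (\<lambda>x. \<Sum>i\<le>n. a i * x ^ i)"
      using real_polynomial_function_imp_sum[OF p] by blast
    then show ?thesis using pw mom
      by (simp add: sum_distrib_right mult.assoc)
  qed
  have cont: "(\<integral>y. c y * h y \<partial>leb01) = 0" if c: "continuous_on UNIV c" for c :: "real \<Rightarrow> real"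
  proof -
    have cb: "c \<in> borel_measurable leb01"
      by (intro borel_measurable_leb01 borel_measurable_continuous_onI c)
    have "bounded (c ` {0..1})"
      by (intro compact_imp_bounded compact_continuous_image continuous_on_subset[OF c]) auto
    then obtain B where "\<forall>y\<in>c ` {0..1}. norm y \<le> B"
      unfolding bounded_iff by blast
    then have B: "\<And>y. y \<in> {0..1} \<Longrightarrow> \<bar>c y\<bar> \<le> B" by simp
    have ch: "integrable leb01 (\<lambda>y. c y * h y)"
      by (rule integrable_leb01_mult_bounded[OF h cb B])
    \<comment> \<open>Replacing \<open>c\<close> by a polynomial within uniform distance
      \<open>e\<close> changes the integral by at most \<open>e\<close> times the L1 norm of
      \<open>h\<close>, and the polynomial contributes 0.\<close>
    have "\<bar>\<integral>y. c y * h y \<partial>leb01\<bar> \<le> e * (\<integral>y. \<bar>h y\<bar> \<partial>leb01)" if e: "e > 0" for e :: real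
    proof -
      obtain p where p: "real_polynomial_function p" "\<And>y. y \<in> {0..1} \<Longrightarrow> \<bar>c y - p y\<bar> < e"
        using Stone_Weierstrass_real_polynomial_function[OF compact_Icc[of 0 1] continuous_on_subset[OF c subset_UNIV] e] by blast
      have pb: "p \<in> borel_measurable leb01"
        using p(1) by (intro borel_measurable_leb01 borel_measurable_continuous_onI continuous_on_polymonial_function)
          (simp add: real_polynomial_function_eq)
      have dh: "integrable leb01 (\<lambda>y. (c y - p y) * h y)"
        using p cb pb by (intro integrable_leb01_mult_bounded[OF h, where B=e]) (auto intro: less_imp_le)
      have ph: "integrable leb01 (\<lambda>y. p y * h y)"
        using Bochner_Integration.integrable_diff[OF ch dh] by (simp add: algebra_simps)
      have "(\<integral>y. c y * h y \<partial>leb01) = (\<integral>y. (c y - p y) * h y + p y * h y \<partial>leb01)"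
        by (simp add: algebra_simps)
      also have "\<dots> = (\<integral>y. (c y - p y) * h y \<partial>leb01)"
        using dh ph poly[OF p(1)] by simp
      also have "\<bar>\<dots>\<bar> \<le> (\<integral>y. \<bar>(c y - p y) * h y\<bar> \<partial>leb01)"
        by (rule integral_abs_bound)
      also have "\<dots> \<le> (\<integral>y. e * \<bar>h y\<bar> \<partial>leb01)"
      proof (rule integral_mono)
        show "integrable leb01 (\<lambda>y. \<bar>(c y - p y) * h y\<bar>)" using dh by (rule integrable_abs)
        show "\<bar>(c y - p y) * h y\<bar> \<le> e * \<bar>h y\<bar>" if "y \<in> space leb01" for y
          using p(2)[of y] that by (auto simp: abs_mult intro!: mult_right_mono)
      qed (use h in simp)
      finally show ?thesis by simp
    qed
    note le = this
    define C where "C = (\<integral>y. \<bar>h y\<bar> \<partial>leb01)"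
    have C: "C \<ge> 0" by (simp add: C_def)
    have "\<bar>\<integral>y. c y * h y \<partial>leb01\<bar> \<le> 0 + e" if "e > 0" for e
    proof -
      \<comment> \<open>The denominator \<open>C + 1\<close> is positive even if the L1 norm
        \<open>C\<close> is 0.\<close>
      have "\<bar>\<integral>y. c y * h y \<partial>leb01\<bar> \<le> e / (C + 1) * C"
        unfolding C_def by (rule le) (use that C in \<open>simp add: C_def[symmetric]\<close>)
      also have "\<dots> \<le> 0 + e" using that C by (simp add: field_simps)
      finally show ?thesis .
    qed
    from field_le_epsilon[OF this] show ?thesis by simp
  qed
  have hm [measurable]: "h \<in> borel_measurable leb01" using h by auto
  \<comment> \<open>The definition of \<open>measurable_on\<close> supplies continuous functions
    that converge to the sign of \<open>h\<close> off a negligible set.\<close>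
  have "(\<lambda>y. sgn (h y)) measurable_on {0..1}"
    by (subst measurable_on_iff_borel_measurable) auto
  then obtain N g where N: "negligible N" and gc: "\<And>n. continuous_on UNIV (g n)"
    and glim: "\<And>x. x \<notin> N \<Longrightarrow> (\<lambda>n. g n x) \<longlonglongrightarrow> (if x \<in> {0..1} then sgn (h x) else 0)"
    unfolding measurable_on_def by metis
  have AEN: "AE y in leb01. y \<notin> N"
  proof -
    have "N \<in> null_sets lebesgue" using N by (simp add: negligible_iff_null_sets)
    then have "N \<inter> {0..1} \<in> null_sets leb01"
      by (auto simp: null_sets_restrict_space null_set_Int2)
    then show ?thesis by (rule AE_I') auto
  qed
  \<comment> \<open>Clipping to [-1, 1] preserves continuity and the limit, whose values lie in that
    interval, and makes |h| a dominating function.\<close>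
  define k where "k n y = max (-1) (min 1 (g n y))" for n y
  have kc: "continuous_on UNIV (k n)" for n
    unfolding k_def by (intro continuous_intros gc)
  have kb: "k n \<in> borel_measurable leb01" for n
    by (intro borel_measurable_leb01 borel_measurable_continuous_onI kc)
  have "(\<lambda>n. \<integral>y. k n y * h y \<partial>leb01) \<longlonglongrightarrow> (\<integral>y. sgn (h y) * h y \<partial>leb01)"
  proof (rule integral_dominated_convergence[where w="\<lambda>y. \<bar>h y\<bar>"])
    show "AE y in leb01. (\<lambda>n. k n y * h y) \<longlonglongrightarrow> sgn (h y) * h y"
      using AEN AE_space
    proof eventually_elim
      case (elim y)
      then have "(\<lambda>n. g n y) \<longlonglongrightarrow> sgn (h y)" using glim[of y] by simp
      then have "(\<lambda>n. k n y) \<longlonglongrightarrow> max (-1) (min 1 (sgn (h y)))"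
        unfolding k_def by (intro tendsto_intros)
      moreover have "max (-1) (min 1 (sgn (h y))) = sgn (h y)" by (simp add: sgn_if)
      ultimately show ?case by (intro tendsto_intros) simp
    qed
    show "AE y in leb01. norm (k n y * h y) \<le> \<bar>h y\<bar>" for n
      by (intro AE_I2) (auto simp: k_def abs_mult intro!: mult_left_le_one_le)
  qed (use h kb in auto)
  then have "(\<integral>y. \<bar>h y\<bar> \<partial>leb01) = 0"
    using cont[OF kc] by (simp add: LIMSEQ_const_iff mult.commute[of "sgn _"] abs_sgn[symmetric])
  then have "AE y in leb01. \<bar>h y\<bar> = 0"
    using h by (subst (asm) integral_nonneg_eq_0_iff_AE) auto
  then show ?thesis by simp
qed

section \<open>The function x ln x\<close>

text \<open>With mean m and s = |x - y| / (2m), the convexity gap is m/2 times (1 + s) ln (1 + s) +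
  (1 - s) ln (1 - s), hence at least m s^2 / 2. Moreover |x - y| = 2ms is at most em + m s^2 / e.
  The free parameter \<open>e\<close> keeps the bound linear in the gap, so that it can be
  integrated; a Pinsker inequality would have a square root here.\<close>

lemma strongly_midpoint_convex_x_ln_x:
  fixes x y :: real
  assumes "x \<ge> 0" "y \<ge> 0" "e > 0"
  shows "\<bar>x - y\<bar> \<le> e * (x + y) / 2
    + 2 / e * ((x * ln x + y * ln y) / 2 - (x + y) / 2 * ln ((x + y) / 2))"
proof -
  \<comment> \<open>The difference of the two sides vanishes at 0 and has derivative
    \<open>?g\<close>, which also vanishes at 0 and has derivative 2u^2 / (1 - u^2). The endpoint
    \<open>s = 1\<close>, where the claim reads 1 \<le> 2 ln 2, is treated apart because ln (1 - s)
    is singular there.\<close>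
  have main: "s\<^sup>2 \<le> (1 + s) * ln (1 + s) + (1 - s) * ln (1 - s)" if s: "0 \<le> s" "s \<le> 1" for s :: real
  proof (cases "s = 1")
    case True
    then show ?thesis using ln2_ge_two_thirds by simp
  next
    case False
    let ?g = "\<lambda>t::real. ln (1 + t) - ln (1 - t) - 2 * t"
    let ?f = "\<lambda>t::real. (1 + t) * ln (1 + t) + (1 - t) * ln (1 - t) - t\<^sup>2"
    have g0: "0 \<le> ?g t" if t: "0 \<le> t" "t < 1" for t
    proof -
      have "?g 0 \<le> ?g t"
      proof (rule DERIV_nonneg_imp_nondecreasing[OF t(1)])
        fix u assume u: "0 \<le> u" "u \<le> t"
        have "(?g has_real_derivative (1 / (1 + u) + 1 / (1 - u) - 2)) (at u)"
          using u t by (auto intro!: derivative_eq_intros)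
        moreover have "1 / (1 + u) + 1 / (1 - u) - 2 = 2 * u\<^sup>2 / ((1 + u) * (1 - u))"
          using u t by (simp add: divide_simps) (simp add: algebra_simps power2_eq_square)
        ultimately show "\<exists>D. (?g has_real_derivative D) (at u) \<and> 0 \<le> D"
          using u t by (intro exI[of _ "1 / (1 + u) + 1 / (1 - u) - 2"]) simp
      qed
      then show ?thesis by simp
    qed
    have "?f 0 \<le> ?f s"
    proof (rule DERIV_nonneg_imp_nondecreasing[OF s(1)])
      fix u assume u: "0 \<le> u" "u \<le> s"
      then have u1: "u < 1" using False s by simp
      have "(?f has_real_derivative ?g u) (at u)"
        using u u1 by (auto intro!: derivative_eq_intros)
      then show "\<exists>D. (?f has_real_derivative D) (at u) \<and> 0 \<le> D"
        using g0[of u] u u1 by blast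
    qed
    then show ?thesis by simp
  qed
  define m where "m = (x + y) / 2"
  show ?thesis
  proof (cases "m = 0")
    case True
    then have "x = 0" "y = 0" using assms by (auto simp: m_def)
    then show ?thesis by simp
  next
    case False
    then have m: "m > 0" using assms by (simp add: m_def)
    define T where "T = (x * ln x + y * ln y) / 2 - m * ln m"
    define s where "s = \<bar>x - y\<bar> / (2 * m)"
    have "\<bar>x - y\<bar> \<le> x + y" using assms by linarith
    then have s: "0 \<le> s" "s \<le> 1" using assms m by (auto simp: s_def m_def field_simps)
    \<comment> \<open>The form multiplied by m (1 + t) holds at \<open>t = -1\<close> too, both
      sides being 0; this is the case where one of the two points is 0.\<close>
    have ln_eq: "m * (1 + t) * ln (m * (1 + t)) = m * (1 + t) * ln m + m * ((1 + t) * ln (1 + t))"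
      if "-1 \<le> t" for t
    proof (cases "t = -1")
      case False
      then have "ln (m * (1 + t)) = ln m + ln (1 + t)"
        using m that by (intro ln_mult_pos) auto
      then show ?thesis by (simp only:) (simp add: algebra_simps)
    qed simp
    \<comment> \<open>Which of the two points is the larger one does not matter, since the sum below
      is symmetric.\<close>
    have "{x, y} = {m * (1 + s), m * (1 + - s)}"
      using m by (auto simp: s_def field_simps abs_if m_def doubleton_eq_iff)
    then have "x * ln x + y * ln y = m * (1 + s) * ln (m * (1 + s)) + m * (1 + - s) * ln (m * (1 + - s))"
      by (auto simp: doubleton_eq_iff)
    also have "\<dots> = 2 * (m * ln m) + m * ((1 + s) * ln (1 + s) + (1 + - s) * ln (1 + - s))"
      using s by (subst (1 2) ln_eq) (simp_all add: algebra_simps)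
    also have "\<dots> \<ge> 2 * (m * ln m) + m * s\<^sup>2"
      using mult_left_mono[OF main[OF s], of m] m by simp
    finally have "2 * (m * ln m) + m * s\<^sup>2 \<le> x * ln x + y * ln y" .
    moreover have "b / 2 \<le> c / 2 - a" if "2 * a + b \<le> c" for a b c :: real
      using that by linarith
    ultimately have "m * s\<^sup>2 / 2 \<le> T" unfolding T_def by blast
    then have "2 / e * (m * s\<^sup>2 / 2) \<le> 2 / e * T"
      using assms by (intro mult_left_mono) auto
    \<comment> \<open>Completing the square gives the arithmetic-geometric mean step.\<close>
    moreover have "e * m + 2 / e * (m * s\<^sup>2 / 2) - 2 * m * s = m / e * (e - s)\<^sup>2"
      using assms by (simp add: power2_eq_square field_simps)
    moreover have "0 \<le> m / e * (e - s)\<^sup>2" using m assms by simp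
    moreover have "\<bar>x - y\<bar> = 2 * m * s" using m by (simp add: s_def)
    moreover have "e * (x + y) / 2 = e * m" by (simp add: m_def)
    ultimately show ?thesis unfolding m_def[symmetric] T_def[symmetric] by linarith
  qed
qed

text \<open>This is ln t \<le> t - 1 at t = 1/x. The bound is cruder than -1/e but suffices to make
  x ln x + 1 nonnegative.\<close>

lemma x_ln_x_ge: "x * ln x \<ge> -1" if "x \<ge> 0" for x :: real
proof (cases "x = 0")
  case False
  then have x: "x > 0" using that by simp
  have "x * (1 - 1 / x) \<le> x * ln x"
    using ln_le_minus_one[of "1 / x"] x by (intro mult_left_mono) (simp_all add: ln_div)
  then show ?thesis using x by (simp add: algebra_simps)
qed simp

text \<open>The inequality ln t \<le> t - 1 at t = 1 / sqrt x bounds x ln x from below, and at t = x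
  from above. The right-hand side vanishes continuously at 0.\<close>

lemma abs_x_ln_x_le: "\<bar>x * ln x\<bar> \<le> 2 * sqrt x + x\<^sup>2" if "x \<ge> 0" for x :: real
proof (cases "x = 0")
  case False
  then have x: "x > 0" using that by simp
  have "ln (1 / sqrt x) \<le> 1 / sqrt x"
    using ln_le_minus_one[of "1 / sqrt x"] x by simp
  then have "x * - ln x \<le> x * (2 / sqrt x)"
    using x by (intro mult_left_mono) (simp_all add: ln_div ln_sqrt)
  also have "\<dots> = 2 * sqrt x" using x by (simp add: field_simps)
  finally have "- (x * ln x) \<le> 2 * sqrt x" by simp
  moreover have "x * ln x \<le> x * x"
    using ln_le_minus_one[OF x] x by (intro mult_left_mono) auto
  ultimately show ?thesis
    using x real_sqrt_ge_zero[of x] by (simp add: power2_eq_square abs_le_iff add_increasing add_increasing2)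
qed simp

text \<open>Only \<open>c = 0\<close> lies outside the continuity of ln; there the preceding bound
  squeezes the values to 0, in accordance with 0 ln 0 = 0.\<close>

lemma tendsto_x_ln_x:
  fixes x :: "'a \<Rightarrow> real"
  assumes lim: "(x \<longlongrightarrow> c) F" and nonneg: "\<And>n. 0 \<le> x n"
  shows "((\<lambda>n. x n * ln (x n)) \<longlongrightarrow> c * ln c) F"
proof (cases "c = 0")
  case True
  have "((\<lambda>n. 2 * sqrt (x n) + (x n)\<^sup>2) \<longlongrightarrow> 2 * sqrt c + c\<^sup>2) F"
    by (intro tendsto_intros lim)
  then have "((\<lambda>n. 2 * sqrt (x n) + (x n)\<^sup>2) \<longlongrightarrow> 0) F" using True by simp
  then have "((\<lambda>n. x n * ln (x n)) \<longlongrightarrow> 0) F"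
    by (rule Lim_null_comparison[rotated]) (simp add: abs_x_ln_x_le nonneg del: abs_mult)
  then show ?thesis using True by simp
qed (intro tendsto_intros lim)

section \<open>Fractional moments\<close>

text \<open>At y = 0 the kernel has the value 1 instead of 0, because ln 0 = 0 in HOL; this only affects a
  null set.\<close>

lemma fractional_moment_transform:
  fixes h :: "real \<Rightarrow> real"
  assumes h: "integrable leb01 h"
  defines "F \<equiv> \<lambda>z. \<integral>y. exp (z * of_real (ln y)) * of_real (h y) \<partial>leb01"
  shows "F holomorphic_on {z. Re z > 0}"
    and "Re z > 0 \<Longrightarrow> norm (F z) \<le> (\<integral>y. \<bar>h y\<bar> \<partial>leb01)"
proof -
  have ln_le: "ln y \<le> 0" if "y \<in> {0..1}" for y :: real
    using that by (cases "y = 0") auto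
  have hm [measurable]: "h \<in> borel_measurable leb01" using h by auto
  have km: "(\<lambda>y. exp (z * complex_of_real (ln y))) \<in> borel_measurable leb01" for z
    by (simp add: measurable_restrict_space1 measurable_completion)
  have normE: "norm (exp (z * complex_of_real (ln y))) \<le> 1" if "Re z > 0" "y \<in> {0..1}" for z y
    using that ln_le[OF that(2)] by (simp add: mult_nonneg_nonpos)
  have int: "integrable leb01 (\<lambda>y. exp (z * of_real (ln y)) * complex_of_real (h y))" if "Re z > 0" for z
  proof (rule Bochner_Integration.integrable_bound[OF h])
    show "AE y in leb01. norm (exp (z * of_real (ln y)) * complex_of_real (h y)) \<le> norm (h y)"
      using normE[OF that] by (intro AE_I2) (auto simp: norm_mult intro!: mult_left_le_one_le)
  qed (use km in measurable)
  show "norm (F z) \<le> (\<integral>y. \<bar>h y\<bar> \<partial>leb01)" if "Re z > 0"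
  proof -
    have "norm (F z) \<le> (\<integral>y. norm (exp (z * of_real (ln y)) * complex_of_real (h y)) \<partial>leb01)"
      unfolding F_def by (rule integral_norm_bound)
    also have "\<dots> \<le> (\<integral>y. \<bar>h y\<bar> \<partial>leb01)"
      using normE[OF that] h
      by (intro integral_mono integrable_norm int that integrable_abs)
         (auto simp: norm_mult intro!: mult_left_le_one_le)
    finally show ?thesis .
  qed
  have deriv: "(F has_field_derivative (\<integral>y. of_real (ln y) * exp (z0 * of_real (ln y)) * of_real (h y) \<partial>leb01)) (at z0)"
    if z0: "Re z0 > 0" for z0
  proof -
    \<comment> \<open>Differentiation under the integral takes place on the half-plane
      \<open>S\<close>, which stays away from the imaginary axis; there the derivative of the kernel
      is bounded uniformly in \<open>y\<close>.\<close>
    define \<delta> where "\<delta> = Re z0 / 2"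
    have \<delta>: "\<delta> > 0" using z0 by (simp add: \<delta>_def)
    define S where "S = {z. Re z > \<delta>}"
    have S: "open S" "convex S" "z0 \<in> S"
      using z0 unfolding S_def by (auto simp: open_halfspace_Re_gt convex_halfspace_Re_gt) (simp add: \<delta>_def)
    have lip: "norm (exp (z * of_real (ln y)) - exp (w * complex_of_real (ln y))) \<le> 1 / \<delta> * norm (z - w)"
      if "z \<in> S" "w \<in> S" and y: "y \<in> {0..1}" for z w y
    proof (rule field_differentiable_bound[OF S(2) _ _ that(1,2)])
      fix u assume u: "u \<in> S"
      show "((\<lambda>u. exp (u * complex_of_real (ln y))) has_field_derivative
          of_real (ln y) * exp (u * of_real (ln y))) (at u within S)"
        by (auto intro!: derivative_eq_intros)
      \<comment> \<open>The inequality t \<le> exp t at t = -\<open>\<delta>\<close> ln y bounds |ln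
        y| y^\<open>\<delta>\<close> by 1/\<open>\<delta>\<close>.\<close>
      have "- (\<delta> * ln y) \<le> exp (- (\<delta> * ln y))"
        using exp_ge_add_one_self[of "- (\<delta> * ln y)"] by linarith
      then have "\<delta> * \<bar>ln y\<bar> * exp (\<delta> * ln y) \<le> exp (- (\<delta> * ln y)) * exp (\<delta> * ln y)"
        using ln_le[OF y] by (intro mult_right_mono) auto
      then have "\<delta> * \<bar>ln y\<bar> * exp (\<delta> * ln y) \<le> 1"
        by (simp flip: exp_add)
      then have "\<bar>ln y\<bar> * exp (\<delta> * ln y) \<le> 1 / \<delta>"
        using \<delta> by (simp add: field_simps)
      moreover have "exp (Re u * ln y) \<le> exp (\<delta> * ln y)"
        using u ln_le[OF y] by (simp add: S_def mult_right_mono_neg)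
      ultimately have "\<bar>ln y\<bar> * exp (Re u * ln y) \<le> 1 / \<delta>"
        by (meson abs_ge_zero mult_left_mono order_trans)
      then show "norm (of_real (ln y) * exp (u * of_real (ln y))) \<le> 1 / \<delta>"
        by (simp add: norm_mult)
    qed
    \<comment> \<open>Passing to sequences makes dominated convergence applicable; by the Lipschitz
      bound \<open>lip\<close>, |h| / \<open>\<delta>\<close> dominates all difference
      quotients.\<close>
    have "((\<lambda>w. (F w - F z0) / (w - z0)) \<longlongrightarrow>
        (\<integral>y. of_real (ln y) * exp (z0 * of_real (ln y)) * of_real (h y) \<partial>leb01)) (at z0 within S)"
      unfolding tendsto_at_iff_sequentially
    proof (intro allI impI)
      fix X assume X: "\<forall>i. X i \<in> S - {z0}" and lim: "X \<longlonglongrightarrow> z0"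
      let ?q = "\<lambda>i y. (exp (X i * of_real (ln y)) - exp (z0 * of_real (ln y))) / (X i - z0) * complex_of_real (h y)"
      have Re_pos: "Re (X i) > 0" for i
        using X[rule_format, of i] \<delta> by (simp add: S_def)
      have "(\<lambda>i. \<integral>y. ?q i y \<partial>leb01) \<longlonglongrightarrow>
          (\<integral>y. of_real (ln y) * exp (z0 * of_real (ln y)) * of_real (h y) \<partial>leb01)"
      proof (rule integral_dominated_convergence[where w="\<lambda>y. 1 / \<delta> * \<bar>h y\<bar>"])
        show "AE y in leb01. (\<lambda>i. ?q i y) \<longlonglongrightarrow> of_real (ln y) * exp (z0 * of_real (ln y)) * of_real (h y)"
        proof (intro AE_I2 tendsto_mult tendsto_const)
          fix y :: real
          have "((\<lambda>u. exp (u * complex_of_real (ln y))) has_field_derivative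
            of_real (ln y) * exp (z0 * of_real (ln y))) (at z0)"
            by (auto intro!: derivative_eq_intros)
          then have "((\<lambda>u. (exp (u * of_real (ln y)) - exp (z0 * of_real (ln y))) / (u - z0))
             \<longlongrightarrow> of_real (ln y) * exp (z0 * complex_of_real (ln y))) (at z0)"
            by (simp add: has_field_derivative_iff)
          then show "(\<lambda>i. (exp (X i * of_real (ln y)) - exp (z0 * of_real (ln y))) / (X i - z0))
             \<longlonglongrightarrow> of_real (ln y) * exp (z0 * complex_of_real (ln y))"
            using X lim unfolding tendsto_at_iff_sequentially by (auto simp: o_def)
        qed
        show "AE y in leb01. norm (?q i y) \<le> 1 / \<delta> * \<bar>h y\<bar>" for i
        proof (rule AE_I2)
          fix y assume "y \<in> space leb01"
          then have "y \<in> {0..1}" by simp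
          then have "norm (exp (X i * of_real (ln y)) - exp (z0 * complex_of_real (ln y))) / norm (X i - z0) \<le> 1 / \<delta>"
            using lip[of "X i" z0 y] X S(3) \<delta> by (simp add: field_simps)
          then show "norm (?q i y) \<le> 1 / \<delta> * \<bar>h y\<bar>"
            unfolding norm_mult norm_divide norm_of_real by (rule mult_right_mono) simp
        qed
        show "(\<lambda>y. of_real (ln y) * exp (z0 * of_real (ln y)) * complex_of_real (h y)) \<in> borel_measurable leb01"
          using km[of z0] by (intro borel_measurable_times borel_measurable_of_real) 
            (auto simp: measurable_restrict_space1 measurable_completion)
        show "?q i \<in> borel_measurable leb01" for i
          using km[of z0] km[of "X i"] by measurable
        show "integrable leb01 (\<lambda>y. 1 / \<delta> * \<bar>h y\<bar>)"
          using h by simp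
      qed
      moreover have "(\<integral>y. ?q i y \<partial>leb01) = (F (X i) - F z0) / (X i - z0)" for i
      proof -
        have "(\<integral>y. ?q i y \<partial>leb01) = (\<integral>y. (exp (X i * of_real (ln y)) * complex_of_real (h y)
            - exp (z0 * of_real (ln y)) * complex_of_real (h y)) / (X i - z0) \<partial>leb01)"
          by (simp add: algebra_simps)
        also have "\<dots> = (F (X i) - F z0) / (X i - z0)"
          unfolding F_def integral_divide_zero
          by (subst Bochner_Integration.integral_diff[OF int[OF Re_pos] int[OF z0]]) simp
        finally show ?thesis .
      qed
      ultimately show "((\<lambda>w. (F w - F z0) / (w - z0)) \<circ> X) \<longlonglongrightarrow>
          (\<integral>y. of_real (ln y) * exp (z0 * of_real (ln y)) * of_real (h y) \<partial>leb01)"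
        by (simp only: o_def)
    qed
    then show ?thesis
      using at_within_open[OF S(3,1)] by (simp add: has_field_derivative_iff)
  qed
  show "F holomorphic_on {z. Re z > 0}"
    using deriv by (intro holomorphic_onI) (auto simp: field_differentiable_def intro: has_field_derivative_at_within)
qed

text \<open>The transform vanishes at all \<open>\<alpha> n\<close>, hence at all positive reals,
  which include the orders 1, 2, 3, ... of the power moments. Order 0 lies on the boundary of the
  half-plane and is supplied by \<open>total\<close>.\<close>

lemma fractional_moments_determine:
  fixes h :: "real \<Rightarrow> real" and \<alpha> :: "nat \<Rightarrow> real"
  assumes pos: "\<And>n. n \<ge> 1 \<Longrightarrow> \<alpha> n > 0"
    and inj: "inj_on \<alpha> {1..}"
    and lim0: "\<alpha> \<longlonglongrightarrow> 0"
    and diverges: "filterlim (\<lambda>N. \<Sum>n=1..N. \<alpha> n) at_top sequentially"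
    and h: "integrable leb01 h"
    and total: "(\<integral>y. h y \<partial>leb01) = 0"
    and mom: "\<And>n. n \<ge> 1 \<Longrightarrow> frac_moment (\<alpha> n) h = 0"
  shows "AE y in leb01. h y = 0"
proof -
  define F where "F z = (\<integral>y. exp (z * of_real (ln y)) * of_real (h y) \<partial>leb01)" for z :: complex
  have F_real: "F (of_real a) = of_real (frac_moment a h)" if "a > 0" for a
  proof -
    have "F (of_real a) = (\<integral>y. complex_of_real (exp (a * ln y) * h y) \<partial>leb01)"
      by (simp add: F_def exp_of_real flip: of_real_mult)
    also have "\<dots> = of_real (\<integral>y. exp (a * ln y) * h y \<partial>leb01)"
      by (rule integral_complex_of_real)
    also have "(\<integral>y. exp (a * ln y) * h y \<partial>leb01) = frac_moment a h"
      unfolding frac_moment_def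
    proof (rule integral_cong_AE)
      have "(\<lambda>y. exp (a * ln y)) \<in> borel_measurable leb01" "(\<lambda>y. y powr a) \<in> borel_measurable leb01"
        by (auto intro!: borel_measurable_leb01)
      then show "(\<lambda>y. exp (a * ln y) * h y) \<in> borel_measurable leb01"
        "(\<lambda>y. y powr a * h y) \<in> borel_measurable leb01"
        using h by auto
      \<comment> \<open>At \<open>y = 0\<close> the left kernel is 1 and \<open>y powr a\<close> is
        0; elsewhere they agree.\<close>
      show "AE y in leb01. exp (a * ln y) * h y = y powr a * h y"
        using AE_leb01_neq_0 by eventually_elim (simp add: powr_def)
    qed
    finally show ?thesis .
  qed
  have F0: "F (of_real x) = 0" if "x > 0" for x
  proof (rule bounded_right_half_plane_eq_0[OF _ _ pos inj lim0 diverges _ that])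
    show "F holomorphic_on {z. Re z > 0}"
      using fractional_moment_transform(1)[OF h] by (simp add: F_def[abs_def])
    show "norm (F z) \<le> (\<integral>y. \<bar>h y\<bar> \<partial>leb01)" if "Re z > 0" for z
      using fractional_moment_transform(2)[OF h that] by (simp add: F_def)
    show "F (of_real (\<alpha> n)) = 0" if "n \<ge> 1" for n
      using F_real[OF pos[OF that]] mom[OF that] by simp
  qed
  have "(\<integral>y. y ^ n * h y \<partial>leb01) = 0" for n :: nat
  proof (cases "n = 0")
    case False
    then have "frac_moment (real n) h = 0"
      using F0[of "real n"] F_real[of "real n"] by simp
    moreover have "frac_moment (real n) h = (\<integral>y. y ^ n * h y \<partial>leb01)"
      unfolding frac_moment_def using False
      by (intro Bochner_Integration.integral_cong) (auto simp: powr_realpow')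
    ultimately show ?thesis by simp
  qed (simp add: total)
  then show ?thesis by (rule AE_eq_0_if_power_moments_eq_0[OF h])
qed

section \<open>Maximum entropy solutions\<close>

lemma prob_density01_D:
  assumes "prob_density01 g"
  shows "y \<in> {0..1} \<Longrightarrow> 0 \<le> g y" "integrable leb01 g" "(\<integral>y. g y \<partial>leb01) = 1"
  using assms by (auto simp: prob_density01_def has_bochner_integral_iff)

lemma integrable_powr_mult:
  assumes "integrable leb01 g" "a > 0"
  shows "integrable leb01 (\<lambda>y. y powr a * g y)"
  by (rule integrable_leb01_mult_bounded[OF assms(1), where B=1])
     (use assms(2) in \<open>auto intro!: borel_measurable_leb01 simp: powr_le1\<close>)

text \<open>On the unit interval \<open>y powr a\<close> is at most 1, so a fractional moment is
  1-Lipschitz in the L1 norm.\<close>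

lemma tendsto_frac_moment:
  assumes s: "\<And>n. integrable leb01 (s n)" and g: "integrable leb01 g" and a: "a > 0"
    and lim: "(\<lambda>n. \<integral>y. \<bar>s n y - g y\<bar> \<partial>leb01) \<longlonglongrightarrow> 0"
  shows "(\<lambda>n. frac_moment a (s n)) \<longlonglongrightarrow> frac_moment a g"
proof -
  have "norm (frac_moment a (s n) - frac_moment a g) \<le> (\<integral>y. \<bar>s n y - g y\<bar> \<partial>leb01)" for n
  proof -
    have d: "integrable leb01 (\<lambda>y. s n y - g y)" using s g by simp
    have "frac_moment a (s n) - frac_moment a g = (\<integral>y. y powr a * (s n y - g y) \<partial>leb01)"
      unfolding frac_moment_def right_diff_distrib
      by (rule Bochner_Integration.integral_diff[symmetric]) (intro integrable_powr_mult s g a)+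
    also have "norm \<dots> \<le> (\<integral>y. norm (y powr a * (s n y - g y)) \<partial>leb01)"
      by (rule integral_norm_bound)
    also have "\<dots> \<le> (\<integral>y. \<bar>s n y - g y\<bar> \<partial>leb01)"
      using a by (intro integral_mono integrable_norm integrable_abs integrable_powr_mult d a)
        (auto simp: abs_mult powr_le1 intro!: mult_left_le_one_le)
    finally show ?thesis .
  qed
  then have "(\<lambda>n. frac_moment a (s n) - frac_moment a g) \<longlonglongrightarrow> 0"
    by (intro Lim_null_comparison[OF always_eventually lim]) auto
  then show ?thesis by (simp add: LIM_zero_iff)
qed

lemma entropy01_gt_minus_infty:
  assumes "entropy01 g > -\<infinity>"
  shows "integrable leb01 (\<lambda>y. g y * ln (g y))"
    and "entropy01 g = ereal (- (\<integral>y. g y * ln (g y) \<partial>leb01))"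
  using assms by (auto simp: entropy01_def split: if_splits)

lemma prob_density01_midpoint:
  assumes "prob_density01 g" "prob_density01 h"
  shows "prob_density01 (\<lambda>y. (g y + h y) / 2)"
  using prob_density01_D[OF assms(1)] prob_density01_D[OF assms(2)]
  by (auto simp: prob_density01_def has_bochner_integral_iff)

text \<open>This is strong midpoint convexity of x ln x, integrated; the term e (g + h) / 2
  contributes exactly \<open>e\<close> because both densities have mass 1.\<close>

lemma L1_dist_le_entropy_gap:
  assumes g: "prob_density01 g" and h: "prob_density01 h"
    and eg: "integrable leb01 (\<lambda>y. g y * ln (g y))" and eh: "integrable leb01 (\<lambda>y. h y * ln (h y))"
    and e: "e > 0"
  defines "m \<equiv> \<lambda>y. (g y + h y) / 2"
  shows "integrable leb01 (\<lambda>y. m y * ln (m y))"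
    and "(\<integral>y. \<bar>g y - h y\<bar> \<partial>leb01) \<le> e + 2 / e * (((\<integral>y. g y * ln (g y) \<partial>leb01)
       + (\<integral>y. h y * ln (h y) \<partial>leb01)) / 2 - (\<integral>y. m y * ln (m y) \<partial>leb01))"
proof -
  note gD = prob_density01_D[OF g] and hD = prob_density01_D[OF h]
  have gm [measurable]: "g \<in> borel_measurable leb01" "h \<in> borel_measurable leb01"
    using gD hD by auto
  have conv: "\<bar>g y - h y\<bar> \<le> d * (g y + h y) / 2
      + 2 / d * ((g y * ln (g y) + h y * ln (h y)) / 2 - m y * ln (m y))" if "y \<in> {0..1}" "d > 0" for y d
    using strongly_midpoint_convex_x_ln_x[of "g y" "h y" d] gD(1)[of y] hD(1)[of y] that by (simp add: m_def)
  show em: "integrable leb01 (\<lambda>y. m y * ln (m y))"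
  proof (rule Bochner_Integration.integrable_bound
      [of _ "\<lambda>y. 1 + (g y + h y) + \<bar>g y * ln (g y)\<bar> + \<bar>h y * ln (h y)\<bar>"])
    show "AE y in leb01. norm (m y * ln (m y)) \<le> norm (1 + (g y + h y) + \<bar>g y * ln (g y)\<bar> + \<bar>h y * ln (h y)\<bar>)"
    proof (rule AE_I2)
      fix y assume "y \<in> space leb01"
      then have y: "y \<in> {0..1}" by simp
      have "m y * ln (m y) \<ge> -1"
        using gD(1)[OF y] hD(1)[OF y] by (intro x_ln_x_ge) (simp add: m_def)
      \<comment> \<open>For parameter 2 the convexity gap has coefficient 1; dropping |g - h| leaves
        an upper bound for m ln m.\<close>
      moreover have "m y * ln (m y) \<le> (g y + h y) + \<bar>g y * ln (g y)\<bar> + \<bar>h y * ln (h y)\<bar>"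
        using conv[OF y, of 2] abs_ge_self[of "g y * ln (g y)"] abs_ge_self[of "h y * ln (h y)"]
         abs_ge_zero[of "g y - h y"] abs_ge_zero[of "g y * ln (g y)"] abs_ge_zero[of "h y * ln (h y)"]
        by argo
      ultimately show "norm (m y * ln (m y)) \<le> norm (1 + (g y + h y) + \<bar>g y * ln (g y)\<bar> + \<bar>h y * ln (h y)\<bar>)"
        using gD(1)[OF y] hD(1)[OF y] by simp
    qed
    show "integrable leb01 (\<lambda>y. 1 + (g y + h y) + \<bar>g y * ln (g y)\<bar> + \<bar>h y * ln (h y)\<bar>)"
      using gD hD eg eh by (intro Bochner_Integration.integrable_add integrable_abs)
        (auto intro!: finite_measure.integrable_const finite_measure_lebesgue_on)
  qed (auto simp: m_def)
  have "(\<integral>y. \<bar>g y - h y\<bar> \<partial>leb01) \<le> (\<integral>y. e / 2 * (g y + h y)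
      + 2 / e * ((g y * ln (g y) + h y * ln (h y)) / 2 - m y * ln (m y)) \<partial>leb01)"
    using conv[OF _ e] gD hD eg eh em by (intro integral_mono) auto
  also have "\<dots> = e + 2 / e * (((\<integral>y. g y * ln (g y) \<partial>leb01)
       + (\<integral>y. h y * ln (h y) \<partial>leb01)) / 2 - (\<integral>y. m y * ln (m y) \<partial>leb01))"
    using gD hD eg eh em by simp
  finally show "(\<integral>y. \<bar>g y - h y\<bar> \<partial>leb01) \<le> e + 2 / e * (((\<integral>y. g y * ln (g y) \<partial>leb01)
       + (\<integral>y. h y * ln (h y) \<partial>leb01)) / 2 - (\<integral>y. m y * ln (m y) \<partial>leb01))" .
qed

text \<open>The midpoint of \<open>g\<close> and \<open>h\<close> is admissible, so its entropy does
  not exceed that of \<open>g\<close>, and the convexity gap is at most half of the entropy drop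
  from \<open>g\<close> to \<open>h\<close>. Here \<open>h\<close> may be a solution for a larger
  number of constraints.\<close>

lemma maxent_solution_L1_dist:
  assumes pos: "\<And>i. i \<in> {1..K} \<Longrightarrow> \<alpha> i > 0"
    and g: "maxent_solution \<alpha> \<mu> K g" and h: "solves_moment_problem \<alpha> \<mu> K h"
    and fin: "entropy01 h > -\<infinity>" and e: "e > 0"
  shows "(\<integral>y. \<bar>g y - h y\<bar> \<partial>leb01)
    \<le> e + ((\<integral>y. h y * ln (h y) \<partial>leb01) - (\<integral>y. g y * ln (g y) \<partial>leb01)) / e"
proof -
  define m where "m y = (g y + h y) / 2" for y
  have gs: "solves_moment_problem \<alpha> \<mu> K g" and gmax: "\<And>k. solves_moment_problem \<alpha> \<mu> K k \<Longrightarrow> entropy01 k \<le> entropy01 g"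
    using g by (auto simp: maxent_solution_def)
  have dg: "prob_density01 g" and dh: "prob_density01 h"
    using gs h by (auto simp: solves_moment_problem_def)
  have fg: "entropy01 g > -\<infinity>" using gmax[OF h] fin by (rule less_le_trans[rotated])
  note eg = entropy01_gt_minus_infty[OF fg] and eh = entropy01_gt_minus_infty[OF fin]
  note L1 = L1_dist_le_entropy_gap[OF dg dh eg(1) eh(1) e, folded m_def]
  have "solves_moment_problem \<alpha> \<mu> K m"
    unfolding solves_moment_problem_def
  proof (intro conjI ballI)
    show "prob_density01 m" unfolding m_def by (rule prob_density01_midpoint[OF dg dh])
    fix i assume i: "i \<in> {1..K}"
    have "frac_moment (\<alpha> i) m = (\<integral>y. (y powr \<alpha> i * g y + y powr \<alpha> i * h y) / 2 \<partial>leb01)"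
      by (simp add: frac_moment_def m_def algebra_simps)
    also have "\<dots> = (frac_moment (\<alpha> i) g + frac_moment (\<alpha> i) h) / 2"
      using integrable_powr_mult[OF prob_density01_D(2)[OF dg] pos[OF i]]
        integrable_powr_mult[OF prob_density01_D(2)[OF dh] pos[OF i]]
      by (simp add: frac_moment_def)
    also have "\<dots> = \<mu> i" using gs h i by (simp add: solves_moment_problem_def)
    finally show "frac_moment (\<alpha> i) m = \<mu> i" .
  qed
  from gmax[OF this] have "(\<integral>y. g y * ln (g y) \<partial>leb01) \<le> (\<integral>y. m y * ln (m y) \<partial>leb01)"
    using L1(1) eg(2) by (simp add: entropy01_def)
  then have "((\<integral>y. g y * ln (g y) \<partial>leb01) + (\<integral>y. h y * ln (h y) \<partial>leb01)) / 2 - (\<integral>y. m y * ln (m y) \<partial>leb01)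
    \<le> ((\<integral>y. h y * ln (h y) \<partial>leb01) - (\<integral>y. g y * ln (g y) \<partial>leb01)) / 2"
    by argo
  then have "2 / e * (((\<integral>y. g y * ln (g y) \<partial>leb01) + (\<integral>y. h y * ln (h y) \<partial>leb01)) / 2 - (\<integral>y. m y * ln (m y) \<partial>leb01))
    \<le> 2 / e * (((\<integral>y. h y * ln (h y) \<partial>leb01) - (\<integral>y. g y * ln (g y) \<partial>leb01)) / 2)"
    using e by (intro mult_left_mono) auto
  also have "\<dots> = ((\<integral>y. h y * ln (h y) \<partial>leb01) - (\<integral>y. g y * ln (g y) \<partial>leb01)) / e"
    using e by (simp add: field_simps)
  finally show ?thesis using L1(2) by linarith
qed

section \<open>Convergence of the maximum entropy solutions in entropy and in L1\<close>

theorem theorem3p1: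
  fixes \<alpha> :: "nat \<Rightarrow> real" and f :: "real \<Rightarrow> real" and \<mu> :: "nat \<Rightarrow> real"
    and fK :: "nat \<Rightarrow> real \<Rightarrow> real"
  assumes pos: "\<And>n. n \<ge> 1 \<Longrightarrow> \<alpha> n > 0"
    and distinct: "inj_on \<alpha> {1..}"
    and lim0: "\<alpha> \<longlonglongrightarrow> 0"
    and diverges: "filterlim (\<lambda>N. \<Sum>n=1..N. \<alpha> n) at_top sequentially"
    and dens: "prob_density01 f"
    and finite_entropy: "\<bar>entropy01 f\<bar> \<noteq> \<infinity>"
    and moments: "\<And>i. i \<ge> 1 \<Longrightarrow> \<mu> i = frac_moment (\<alpha> i) f"
    and maxent: "\<And>K. K \<ge> 1 \<Longrightarrow> maxent_solution \<alpha> \<mu> K (fK K)"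
  shows "antimono_on {1..} (\<lambda>K. entropy01 (fK K)) \<and>
         (\<lambda>K. entropy01 (fK K)) \<longlonglongrightarrow> entropy01 f \<and>
         (\<lambda>K. \<integral>y. \<bar>fK K y - f y\<bar> \<partial>leb01) \<longlonglongrightarrow> 0"
proof -
  \<comment> \<open>Further constraints shrink the admissible set, so later solutions remain
    competitors for earlier problems.\<close>
  have solves: "solves_moment_problem \<alpha> \<mu> K (fK L)" if "1 \<le> K" "K \<le> L" for K L
    using maxent[of L] that by (auto simp: maxent_solution_def solves_moment_problem_def)
  have f_solves: "solves_moment_problem \<alpha> \<mu> K f" for K
    using dens moments by (auto simp: solves_moment_problem_def)
  have mono: "entropy01 (fK L) \<le> entropy01 (fK K)" if "1 \<le> K" "K \<le> L" for K L
    using maxent[OF that(1)] solves[OF that] by (simp add: maxent_solution_def)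
  have f_le: "entropy01 f \<le> entropy01 (fK K)" if "1 \<le> K" for K
    using maxent[OF that] f_solves by (simp add: maxent_solution_def)
  have f_fin: "entropy01 f > -\<infinity>" using finite_entropy by auto
  then have fin: "entropy01 (fK K) > -\<infinity>" if "1 \<le> K" for K
    using f_le[OF that] by (rule less_le_trans)
  note ef = entropy01_gt_minus_infty[OF f_fin] and eK = entropy01_gt_minus_infty[OF fin]
  \<comment> \<open>The shift makes every index at least 1, where \<open>maxent\<close> applies;
    \<open>fK 0\<close> is arbitrary.\<close>
  define s where "s n = fK (Suc n)" for n
  \<comment> \<open>\<open>E\<close> is the negative entropy as a real number; it increases along
    \<open>s\<close> and is bounded by its value at \<open>f\<close>.\<close>
  define E where "E g = (\<integral>y. g y * ln (g y) \<partial>leb01)" for g :: "real \<Rightarrow> real"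
  have s_dens: "prob_density01 (s n)" for n
    using solves[of "Suc n" "Suc n"] by (simp add: solves_moment_problem_def s_def)
  note sD = prob_density01_D[OF s_dens]
  have Es: "entropy01 (s n) = ereal (- E (s n))" for n
    using eK(2)[of "Suc n"] by (simp add: s_def E_def)
  have E_mono: "E (s i) \<le> E (s j)" if "i \<le> j" for i j
    using mono[of "Suc i" "Suc j"] that Es by (simp add: s_def)
  have E_f: "E (s n) \<le> E f" for n
    using f_le[of "Suc n"] Es[of n] ef(2) by (simp add: s_def E_def)
  obtain l where l: "(\<lambda>n. E (s n)) \<longlonglongrightarrow> l" and El: "\<And>n. E (s n) \<le> l"
    using incseq_convergent[of "\<lambda>n. E (s n)" "E f"] E_mono E_f by (auto simp: incseq_def)
  have L1: "(\<integral>y. \<bar>s i y - s j y\<bar> \<partial>leb01) \<le> e + (E (s j) - E (s i)) / e"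
    if "i \<le> j" "e > 0" for i j e
    unfolding s_def E_def using that pos
    by (intro maxent_solution_L1_dist[where K="Suc i" and \<alpha>=\<alpha> and \<mu>=\<mu>] maxent solves fin) auto
  have cau: "\<exists>N. \<forall>i\<ge>N. \<forall>j\<ge>N. (\<integral>y. \<bar>s i y - s j y\<bar> \<partial>leb01) < e" if e: "e > 0" for e
  proof -
    \<comment> \<open>Once \<open>E (s i)\<close> is within d^2 of the limit, the bound
      \<open>L1\<close> with parameter \<open>d\<close> gives d + d^2 / d = 2d < e.\<close>
    define d where "d = e / 3"
    have d: "d > 0" using e by (simp add: d_def)
    obtain N where N: "\<And>n. n \<ge> N \<Longrightarrow> E (s n) > l - d * d"
      using order_tendstoD(1)[OF l, of "l - d * d"] d by (auto simp: eventually_sequentially)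
    have "(\<integral>y. \<bar>s i y - s j y\<bar> \<partial>leb01) < e" if "N \<le> i" "i \<le> j" for i j
    proof -
      have "E (s j) - E (s i) \<le> d * d" using N[OF that(1)] El[of j] by linarith
      then have "(E (s j) - E (s i)) / d \<le> d" using d by (simp add: pos_divide_le_eq)
      then have "(\<integral>y. \<bar>s i y - s j y\<bar> \<partial>leb01) \<le> d + d" using L1[OF that(2) d] by linarith
      then show ?thesis using e by (simp add: d_def)
    qed
    then show ?thesis
      by (metis (no_types, lifting) Bochner_Integration.integral_cong abs_minus_commute linear)
  qed
  obtain g r where g: "integrable leb01 g" and r: "strict_mono r"
    and AE_lim: "AE y in leb01. (\<lambda>i. s (r i) y) \<longlonglongrightarrow> g y"
    and L1_lim: "(\<lambda>n. \<integral>y. \<bar>s n y - g y\<bar> \<partial>leb01) \<longlonglongrightarrow> 0"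
    using L1_complete[OF sD(2) cau] by blast
  have "AE y in leb01. g y - f y = 0"
  proof (rule fractional_moments_determine[OF pos distinct lim0 diverges])
    show "integrable leb01 (\<lambda>y. g y - f y)" using g prob_density01_D(2)[OF dens] by simp
    have "(\<lambda>n. \<integral>y. s n y \<partial>leb01) \<longlonglongrightarrow> (\<integral>y. g y \<partial>leb01)"
    proof (rule tendsto_L1_int)
      have "(\<lambda>n. \<integral>\<^sup>+y. ennreal (norm (s n y - g y)) \<partial>leb01) = (\<lambda>n. ennreal (\<integral>y. \<bar>s n y - g y\<bar> \<partial>leb01))"
        using sD(2) g by (simp add: nn_integral_eq_integral)
      then show "(\<lambda>n. \<integral>\<^sup>+y. ennreal (norm (s n y - g y)) \<partial>leb01) \<longlonglongrightarrow> 0"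
        using tendsto_ennrealI[OF L1_lim] by simp
    qed (use sD(2) g in auto)
    then have "(\<integral>y. g y \<partial>leb01) = 1" using sD(3) by (simp add: LIMSEQ_const_iff)
    then show "(\<integral>y. g y - f y \<partial>leb01) = 0" using g prob_density01_D(2,3)[OF dens] by simp
    fix n :: nat assume n: "n \<ge> 1"
    \<comment> \<open>Each single constraint is in force from some index on, so its moment sequence
      is eventually constant.\<close>
    have "frac_moment (\<alpha> n) (s k) = \<mu> n" if "k \<ge> n" for k
      using solves[of "Suc k" "Suc k"] n that by (simp add: s_def solves_moment_problem_def)
    then have "(\<lambda>k. frac_moment (\<alpha> n) (s k)) \<longlonglongrightarrow> \<mu> n"
      by (intro tendsto_eventually eventually_sequentiallyI)
    then have "frac_moment (\<alpha> n) g = \<mu> n"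
      using tendsto_frac_moment[OF sD(2) g pos[OF n] L1_lim] LIMSEQ_unique by blast
    then show "frac_moment (\<alpha> n) (\<lambda>y. g y - f y) = 0"
      using integrable_powr_mult[OF g pos[OF n]] moments[OF n]
        integrable_powr_mult[OF prob_density01_D(2)[OF dens] pos[OF n]]
      by (simp add: frac_moment_def right_diff_distrib)
  qed
  then have gf: "AE y in leb01. g y = f y" by simp
  have f_meas: "f \<in> borel_measurable leb01" using prob_density01_D(2)[OF dens] by auto
  have "(\<integral>y. \<bar>s n y - g y\<bar> \<partial>leb01) = (\<integral>y. \<bar>s n y - f y\<bar> \<partial>leb01)" for n
    using gf sD(2) g f_meas by (intro integral_cong_AE) auto
  then have "(\<lambda>n. \<integral>y. \<bar>fK (Suc n) y - f y\<bar> \<partial>leb01) \<longlonglongrightarrow> 0"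
    using L1_lim by (simp add: s_def)
  then have part3: "(\<lambda>K. \<integral>y. \<bar>fK K y - f y\<bar> \<partial>leb01) \<longlonglongrightarrow> 0"
    by (rule LIMSEQ_imp_Suc)
  have const: "integrable leb01 (\<lambda>y. c)" "measure leb01 {0..1} = 1" for c :: real
    by (auto intro!: finite_measure.integrable_const finite_measure_lebesgue_on simp: measure_restrict_space)
  \<comment> \<open>The summand 1 makes the integrands nonnegative and adds exactly 1 to each
    integral. The bound \<open>El\<close> holds for every index, in particular along the subsequence
    \<open>r\<close>.\<close>
  have "(\<integral>y. f y * ln (f y) + 1 \<partial>leb01) \<le> l + 1"
  proof (rule Fatou_integral_le(2)[where u="\<lambda>n y. s (r n) y * ln (s (r n) y) + 1"])
    have int: "integrable leb01 (\<lambda>y. s n y * ln (s n y))" for n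
      using eK(1)[of "Suc n"] by (simp add: s_def)
    show "integrable leb01 (\<lambda>y. s (r n) y * ln (s (r n) y) + 1)" for n
      using int const by simp
    show "(\<integral>y. s (r n) y * ln (s (r n) y) + 1 \<partial>leb01) \<le> l + 1" for n
      using int[of "r n"] const El[of "r n"] by (simp add: E_def)
    show "AE y in leb01. 0 \<le> s (r n) y * ln (s (r n) y) + 1" for n
    proof (rule AE_I2)
      fix y assume "y \<in> space leb01"
      then have "s (r n) y * ln (s (r n) y) \<ge> -1" by (intro x_ln_x_ge sD(1)) simp
      then show "0 \<le> s (r n) y * ln (s (r n) y) + 1" by linarith
    qed
    show "AE y in leb01. (\<lambda>n. s (r n) y * ln (s (r n) y) + 1) \<longlonglongrightarrow> f y * ln (f y) + 1"
      using gf AE_lim AE_space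
    proof eventually_elim
      case (elim y)
      then have "\<And>n. 0 \<le> s (r n) y" by (intro sD(1)) simp
      then show ?case
        using elim by (intro tendsto_add tendsto_const tendsto_x_ln_x) auto
    qed
    show "(\<lambda>y. f y * ln (f y) + 1) \<in> borel_measurable leb01" using f_meas by measurable
  qed
  then have "E f \<le> l" using const ef(1) by (simp add: E_def)
  \<comment> \<open>The opposite inequality comes from admissibility of \<open>f\<close> in every
    truncated problem; together they identify \<open>l\<close> with \<open>E f\<close>.\<close>
  moreover have "l \<le> E f" using l E_f by (intro LIMSEQ_le_const2) auto
  ultimately have "(\<lambda>n. entropy01 (s n)) \<longlonglongrightarrow> entropy01 f"
    using l Es ef(2) by (auto simp: E_def intro!: tendsto_intros)
  then have part2: "(\<lambda>K. entropy01 (fK K)) \<longlonglongrightarrow> entropy01 f"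
    unfolding s_def by (rule LIMSEQ_imp_Suc)
  have "antimono_on {1..} (\<lambda>K. entropy01 (fK K))"
    using mono by (auto simp: monotone_on_def)
  then show ?thesis using part2 part3 by blast
qed
end
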